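(* For the rhombus game on the triangular grid with $n$ winning sets, $\mathrm{SC}(\mathcal G_{\lozenge},4)\ge \frac{n}{78}-o(n)$.
   Context: An $s$-of-$k$ game on a $k$-uniform hypergraph $(V,\mathcal F)$ (winning sets are $k$-element subsets of the finite set $V$), $1\le s\le k$: Maker and Breaker alternately claim unclaimed vertices, Maker first, until all are claimed; the score is the number of winning sets in which Maker claimed at least $s$ vertices (Maker maximizes, Breaker minimizes). $\mathrm{SC}(\mathcal H,s)$ is the score under optimal play of both players. $\mathcal G_{\lozenge}$ is the hypergraph whose vertices are the points of a finite portion of the triangular lattice and whose winning sets are the vertex sets of all rhombi formed by two unit triangles sharing an edge, in all three orientations, so $k=4$. Grids are assumed "two-dimensional": the number of winning sets within constant distance of the boundary is $o(n)$, where $n$ is the number of winning sets; $o(n)$ refers to $n\to\infty$. *)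

theory Defs
  imports Complex_Main "HOL-Library.Landau_Symbols"
begin

type_synonym 'a hypergraph = "'a set \<times> 'a set set"

definition uniform_hypergraph :: "nat \<Rightarrow> 'a hypergraph \<Rightarrow> bool" where
  "uniform_hypergraph k H \<longleftrightarrow> finite (fst H) \<and> (\<forall>A\<in>snd H. A \<subseteq> fst H \<and> card A = k)"

definition score :: "'a hypergraph \<Rightarrow> nat \<Rightarrow> 'a set \<Rightarrow> nat" where
  "score H s M = card {A \<in> snd H. s \<le> card (A \<inter> M)}"

datatype player = Maker | Breaker

text \<open>The minimax value of a position: \<open>U\<close> is the set of unclaimed vertices, \<open>M\<close> the set
  of vertices already claimed by Maker, and the player given is the one to move. The infinite
  case only serves to make the function total.\<close>

function game_value :: "'a hypergraph \<Rightarrow> nat \<Rightarrow> player \<Rightarrow> 'a set \<Rightarrow> 'a set \<Rightarrow> nat" where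
  "game_value H s p U M =
     (if infinite U \<or> U = {} then score H s M
      else case p of
        Maker \<Rightarrow> Max ((\<lambda>v. game_value H s Breaker (U - {v}) (insert v M)) ` U)
      | Breaker \<Rightarrow> Min ((\<lambda>v. game_value H s Maker (U - {v}) M) ` U))"
  by pat_completeness auto
termination
  by (relation "measure (\<lambda>(H, s, p, U, M). card U)") (auto simp: card_gt_0_iff)

declare game_value.simps [simp del]

definition SC :: "'a hypergraph \<Rightarrow> nat \<Rightarrow> nat" where
  "SC H s = game_value H s Maker (fst H) {}"

text \<open>The triangular lattice is coordinatised by pairs of integers with respect to the basis
  \<open>1\<close>, \<open>cis (pi / 3)\<close> of the plane.\<close>

type_synonym tri_vertex = "int \<times> int"

definition tri_point :: "tri_vertex \<Rightarrow> complex" where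
  "tri_point p = of_int (fst p) + of_int (snd p) * cis (pi / 3)"

definition tri_dist :: "tri_vertex \<Rightarrow> tri_vertex \<Rightarrow> real" where
  "tri_dist p q = dist (tri_point p) (tri_point q)"

definition unit_triangle :: "tri_vertex set \<Rightarrow> bool" where
  "unit_triangle T \<longleftrightarrow> card T = 3 \<and> (\<forall>p\<in>T. \<forall>q\<in>T. p \<noteq> q \<longrightarrow> tri_dist p q = 1)"

definition rhombus :: "tri_vertex set \<Rightarrow> bool" where
  "rhombus R \<longleftrightarrow> (\<exists>S T. unit_triangle S \<and> unit_triangle T \<and> card (S \<inter> T) = 2 \<and> R = S \<union> T)"

definition rhombus_grid :: "tri_vertex set \<Rightarrow> tri_vertex hypergraph" where
  "rhombus_grid V = (V, {R. rhombus R \<and> R \<subseteq> V})"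

definition grid_boundary :: "tri_vertex set \<Rightarrow> tri_vertex set" where
  "grid_boundary V = {p \<in> V. \<exists>q. tri_dist p q = 1 \<and> q \<notin> V}"

definition sets_near_boundary :: "real \<Rightarrow> tri_vertex set \<Rightarrow> tri_vertex set set" where
  "sets_near_boundary d V =
     {R \<in> snd (rhombus_grid V). \<exists>p\<in>R. \<exists>q\<in>grid_boundary V. tri_dist p q \<le> d}"

lemma tri_dist_eq:
  "tri_dist (a, b) (c, d) =
     sqrt (real_of_int ((a - c)\<^sup>2 + (a - c) * (b - d) + (b - d)\<^sup>2))"
proof -
  have "(tri_dist (a, b) (c, d))\<^sup>2 =
      (real_of_int (a - c) + real_of_int (b - d) / 2)\<^sup>2 + (real_of_int (b - d) * (sqrt 3 / 2))\<^sup>2"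
    by (simp add: tri_dist_def tri_point_def dist_norm cmod_power2 cos_60 sin_60 algebra_simps)
       (simp add: field_simps power2_eq_square)
  also have "\<dots> = real_of_int ((a - c)\<^sup>2 + (a - c) * (b - d) + (b - d)\<^sup>2)"
    by (simp add: field_simps power2_eq_square)
  finally show ?thesis
    by (metis real_sqrt_abs abs_of_nonneg tri_dist_def zero_le_dist)
qed

lemma tri_dist_eq_1_iff:
  "tri_dist (a, b) (c, d) = 1 \<longleftrightarrow>
     (c - a, d - b) \<in> {(1, 0), (0, 1), (-1, 1), (-1, 0), (0, -1), (1, -1)}"
proof -
  define x y where xy: "x = c - a" "y = d - b"
  have "tri_dist (a, b) (c, d) = 1 \<longleftrightarrow> real_of_int ((a - c)\<^sup>2 + (a - c) * (b - d) + (b - d)\<^sup>2) = 1"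
    by (simp only: tri_dist_eq real_sqrt_eq_1_iff)
  also have "\<dots> \<longleftrightarrow> (a - c)\<^sup>2 + (a - c) * (b - d) + (b - d)\<^sup>2 = 1"
    by linarith
  also have "\<dots> \<longleftrightarrow> x\<^sup>2 + x * y + y\<^sup>2 = 1"
    by (simp add: xy power2_eq_square algebra_simps)
  also have "\<dots> \<longleftrightarrow> (x, y) \<in> {(1, 0), (0, 1), (-1, 1), (-1, 0), (0, -1), (1, -1)}"
  proof
    assume eq: "x\<^sup>2 + x * y + y\<^sup>2 = 1"
    have "(2 * x + y)\<^sup>2 + 3 * y\<^sup>2 = 4 * (x\<^sup>2 + x * y + y\<^sup>2)"
      "(2 * y + x)\<^sup>2 + 3 * x\<^sup>2 = 4 * (x\<^sup>2 + x * y + y\<^sup>2)"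
      by (simp_all add: power2_eq_square algebra_simps)
    with eq have "3 * y\<^sup>2 \<le> 4" "3 * x\<^sup>2 \<le> 4"
      by (metis le_add_same_cancel2 mult.right_neutral zero_le_power2)+
    hence "y\<^sup>2 < 2\<^sup>2" "x\<^sup>2 < 2\<^sup>2" by simp_all
    hence "\<bar>y\<bar> < 2" "\<bar>x\<bar> < 2"
      using power_less_imp_less_base[of "\<bar>y\<bar>" 2 2] power_less_imp_less_base[of "\<bar>x\<bar>" 2 2] by simp_all
    hence "x \<in> {-1, 0, 1}" "y \<in> {-1, 0, 1}" by auto
    with eq show "(x, y) \<in> {(1, 0), (0, 1), (-1, 1), (-1, 0), (0, -1), (1, -1)}"
      by auto
  qed auto
  finally show ?thesis by (simp add: xy)
qed

lemma rhombus_grid_uniform: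
  assumes "finite V"
  shows "uniform_hypergraph 4 (rhombus_grid V)"
proof -
  have "card R = 4" if R: "rhombus R" for R
  proof -
    obtain S T where ST: "card S = 3" "card T = 3" "card (S \<inter> T) = 2" "R = S \<union> T"
      using R by (auto simp: rhombus_def unit_triangle_def)
    have "finite S" "finite T" using ST by (auto intro: card_ge_0_finite)
    from card_Un_Int[OF this] ST show ?thesis by simp
  qed
  thus ?thesis using assms by (auto simp: uniform_hypergraph_def rhombus_grid_def)
qed

end

theory Submission imports Defs begin

text \<open>The lattice is tiled by the translates of the 13-point star (a hexagon with its centre and six
  tips) by a sublattice of index 13. Whoever of the two players first enters a star decides it:
  if Maker starts at the centre, he answers every reply of Breaker on the opposite side and obtains
  a double threat, so that he completes a rhombus inside the star. Answering Breaker in the star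
  in which Breaker moves, and opening a new star whenever Breaker enters a fresh one, Maker wins
  at least half of the stars contained in \<open>V\<close>. As there are about three rhombi per
  vertex, there are about \<open>n / 39\<close> such stars.\<close>

section \<open>Local wins\<close>

text \<open>In \<open>maker_wins F C M\<close> it is Breaker's turn, \<open>M\<close> is claimed by Maker and
  \<open>C\<close> is the set of points not claimed by Breaker. A reply \<open>w\<close> that Maker already owns and a move
  \<open>v\<close> of Breaker outside \<open>C\<close> are allowed: this makes the predicate monotone in \<open>M\<close> and \<open>C\<close>,
  and accounts for moves played elsewhere.\<close>

inductive maker_wins :: "'a set set \<Rightarrow> 'a set \<Rightarrow> 'a set \<Rightarrow> bool" for F where
  complete: "A \<in> F \<Longrightarrow> A \<subseteq> M \<Longrightarrow> maker_wins F C M"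
| reply: "(\<And>v. v \<notin> M \<Longrightarrow> \<exists>w\<in>C - {v}. maker_wins F (C - {v}) (insert w M)) \<Longrightarrow> maker_wins F C M"

text \<open>A reply prescribed in the smaller position is still available in the larger one. This
  lets a region survive whatever Maker does elsewhere.\<close>

lemma maker_wins_mono:
  assumes "maker_wins F C M" "C \<subseteq> C'" "M \<subseteq> M'"
  shows "maker_wins F C' M'"
  using assms
proof (induction arbitrary: C' M')
  case (complete A M C)
  then show ?case by (meson maker_wins.complete order_trans)
next
  case (reply M C)
  show ?case
  proof (rule maker_wins.reply)
    fix v assume "v \<notin> M'"
    with reply.prems have "v \<notin> M" by blast
    from reply.IH[OF this] obtain w where w: "w \<in> C - {v}"
      and IH: "\<And>C' M'. C - {v} \<subseteq> C' \<Longrightarrow> insert w M \<subseteq> M' \<Longrightarrow> maker_wins F C' M'"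
      by (elim bexE conjE) simp
    have "maker_wins F (C' - {v}) (insert w M')"
      using reply.prems by (intro IH) auto
    then show "\<exists>w\<in>C' - {v}. maker_wins F (C' - {v}) (insert w M')"
      using w reply.prems by (intro bexI[of _ w]) auto
  qed
qed

text \<open>\<open>W\<close> holds at most one point: it is empty if a winning set is already
  complete, and otherwise it is the answer to \<open>v\<close>.\<close>

lemma maker_wins_reply:
  assumes "maker_wins F C M" "v \<notin> M"
  obtains W w where "W \<subseteq> C - {v}" "W \<subseteq> {w}" "maker_wins F (C - {v}) (M \<union> W)"
  using assms
proof (cases rule: maker_wins.cases)
  case (complete A)
  then show ?thesis using that[of "{}"] by (auto intro: maker_wins.complete)
next
  case reply
  then obtain w where "w \<in> C - {v}" "maker_wins F (C - {v}) (insert w M)" using assms(2) by blast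
  then show ?thesis using that[of "{w}" w] by simp
qed

text \<open>Every prescribed reply is already owned, so each use of \<open>reply\<close> leaves
  \<open>M\<close> unchanged, and the derivation, being well-founded, must end in
  \<open>complete\<close>. A point outside \<open>M\<close> is essential: for
  \<open>M = UNIV\<close> the premise of \<open>reply\<close> is vacuous.\<close>

lemma maker_wins_final:
  assumes "maker_wins F C M" "C \<subseteq> M" "M \<noteq> UNIV"
  shows "\<exists>A\<in>F. A \<subseteq> M"
  using assms
proof induction
  case (reply M C)
  then obtain v where "v \<notin> M" by blast
  from reply.IH[OF this] obtain w where w: "w \<in> C - {v}"
    and IH: "C - {v} \<subseteq> insert w M \<Longrightarrow> insert w M \<noteq> UNIV \<Longrightarrow> \<exists>A\<in>F. A \<subseteq> insert w M"
    by (elim bexE conjE) simp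
  have "insert w M = M" using w reply.prems(1) by blast
  with IH reply.prems show ?case by auto
qed blast

text \<open>Picture \<open>o'\<close> as the centre, \<open>p0\<close> to \<open>p4\<close> as
  consecutive neighbours of it, and \<open>t1\<close>, \<open>t2\<close> as the tips over the edges
  \<open>p1 p2\<close> and \<open>p2 p3\<close>. Maker takes \<open>p2\<close>, then
  \<open>p3\<close> or, failing that, \<open>p1\<close>, and owns a triangle with two open
  completions.\<close>

lemma maker_wins_fan:
  assumes F: "{p0, o', p1, p2} \<in> F" "{o', p1, p2, t1} \<in> F" "{p1, o', p2, p3} \<in> F"
      "{o', p2, p3, t2} \<in> F" "{p2, o', p3, p4} \<in> F"
    and C: "{p0, p1, p2, p3, p4, t1, t2} \<subseteq> C" and "o' \<in> M"
    and dist: "distinct [p0, p1, p2, p3, p4, t1, t2]"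
  shows "\<exists>w\<in>C. maker_wins F C (insert w M)"
proof -
  \<comment> \<open>Double threat: Breaker can take only one of \<open>x\<close> and
    \<open>y\<close>.\<close>
  have double: "maker_wins F D N"
    if "insert x K \<in> F" "insert y K \<in> F" "K \<subseteq> N" "{x, y} \<subseteq> D" "x \<noteq> y" for x y K D N
  proof (rule reply)
    fix v
    have "{x, y} - {v} \<noteq> {}" using that(5) by auto
    then obtain z where "z \<in> {x, y} - {v}" by blast
    with that show "\<exists>w\<in>D - {v}. maker_wins F (D - {v}) (insert w N)"
      by (intro bexI[of _ z] complete[of "insert z K"]) auto
  qed
  have "maker_wins F C (insert p2 M)"
  proof (rule reply)
    fix v
    show "\<exists>w\<in>C - {v}. maker_wins F (C - {v}) (insert w (insert p2 M))"
    proof (cases "v = p3")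
      case True
      \<comment> \<open>The triangle \<open>o' p1 p2\<close> extends by \<open>p0\<close> and by
        \<open>t1\<close>, neither of which is \<open>p3\<close>.\<close>
      have "maker_wins F (C - {v}) (insert p1 (insert p2 M))"
        by (rule double[of p0 "{o', p1, p2}" t1])
           (use assms True in \<open>auto simp: insert_commute\<close>)
      then show ?thesis using True C dist by auto
    next
      case False
      \<comment> \<open>The triangle \<open>o' p2 p3\<close> has three completions, and
        \<open>v\<close> spoils at most one.\<close>
      have "\<exists>x\<in>{p1, p4, t2} - {v}. \<exists>y\<in>{p1, p4, t2} - {v}. x \<noteq> y"
        using dist by auto
      then obtain x y where xy: "x \<in> {p1, p4, t2} - {v}" "y \<in> {p1, p4, t2} - {v}" "x \<noteq> y"
        by blast
      have "maker_wins F (C - {v}) (insert p3 (insert p2 M))"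
        by (rule double[of x "{o', p2, p3}" y])
           (use assms xy in \<open>auto simp: insert_commute\<close>)
      then show ?thesis using False C by auto
    qed
  qed
  then show ?thesis using C by blast
qed

section \<open>Playing on disjoint regions\<close>

definition sets_within :: "'a hypergraph \<Rightarrow> 'a set \<Rightarrow> 'a set set" where
  "sets_within H T = {A \<in> snd H. A \<subseteq> T}"

text \<open>One completed set is chosen per region; disjointness and nonemptiness make the choice
  injective.\<close>

lemma card_le_score:
  assumes H: "finite (snd H)" "\<And>A. A \<in> snd H \<Longrightarrow> A \<noteq> {} \<and> s \<le> card A"
    and disj: "pairwise disjnt R"
    and full: "\<And>T. T \<in> R \<Longrightarrow> \<exists>A\<in>sets_within H T. A \<subseteq> M"
  shows "card R \<le> score H s M"
proof -
  obtain f where f: "\<And>T. T \<in> R \<Longrightarrow> f T \<in> sets_within H T \<and> f T \<subseteq> M"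
    using full by metis
  have "inj_on f R"
  proof (rule inj_onI)
    fix S T assume ST: "S \<in> R" "T \<in> R" "f S = f T"
    then have "f S \<subseteq> S" "f S \<subseteq> T" "f S \<noteq> {}"
      using f[of S] f[of T] H(2) by (auto simp: sets_within_def)
    with ST disj show "S = T" unfolding pairwise_def disjnt_def by blast
  qed
  moreover have "f ` R \<subseteq> {A \<in> snd H. s \<le> card (A \<inter> M)}"
    using f H(2) by (auto simp: sets_within_def Int_absorb2)
  ultimately show ?thesis
    unfolding score_def using H(1) by (auto intro: card_inj_on_le)
qed

lemma game_value_empty [simp]: "game_value H s p {} M = score H s M"
  by (simp add: game_value.simps)

text \<open>If Maker already owns the point he would like to claim, an arbitrary move does no harm.\<close>

lemma game_value_Maker_ge:
  assumes "finite U" "U \<inter> M = {}" "W \<subseteq> U \<union> M" "W \<subseteq> {w}"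
    and step: "\<And>U' M'. \<lbrakk>U' \<subseteq> U; U' \<union> M' = U \<union> M; U' \<inter> M' = {}; M \<union> W \<subseteq> M'\<rbrakk>
      \<Longrightarrow> k \<le> game_value H s Breaker U' M'"
  shows "k \<le> game_value H s Maker U M"
proof (cases "U = {}")
  case True
  with step[of U M] assms show ?thesis by auto
next
  case False
  then obtain u where u: "u \<in> U" "W \<subseteq> insert u M"
    using assms(3,4) by (cases "W \<subseteq> M") blast+
  have "k \<le> game_value H s Breaker (U - {u}) (insert u M)"
    by (rule step) (use u assms(2) in auto)
  also have "\<dots> \<le> game_value H s Maker U M"
    using False assms(1) u(1) by (subst (2) game_value.simps) (auto intro!: Max_ge)
  finally show ?thesis .
qed

text \<open>The regions in \<open>act\<close> have been opened by Maker, those in \<open>fresh\<close> have not been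
  entered by Breaker.\<close>

lemma game_value_Breaker_ge:
  fixes H :: "'a hypergraph"
  assumes inf: "infinite (UNIV :: 'a set)"
    and H: "finite (snd H)" "\<And>A. A \<in> snd H \<Longrightarrow> A \<noteq> {} \<and> s \<le> card A"
    and "finite U" "finite M" "U \<inter> M = {}"
    and "finite act" "finite fresh" "act \<inter> fresh = {}" "pairwise disjnt (act \<union> fresh)"
    and "\<And>T. T \<in> act \<Longrightarrow> maker_wins (sets_within H T) ((U \<union> M) \<inter> T) M"
    and "\<And>T. T \<in> fresh \<Longrightarrow> T \<subseteq> U \<union> M"
    and "\<And>T. T \<in> fresh \<Longrightarrow> \<exists>x\<in>T. maker_wins (sets_within H T) T {x}"
  shows "card act + card fresh div 2 \<le> game_value H s Breaker U M"
  using assms(4-)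
proof (induction "card U" arbitrary: U M act fresh rule: less_induct)
  case less
  note fin = less.prems(1,2,4,5) and disj = less.prems(6,7)
    and act = less.prems(8) and fresh = less.prems(9,10)
  show ?case
  proof (cases "U = {}")
    case True
    \<comment> \<open>At the end of the game a fresh region lies wholly in \<open>M\<close>, so it
      too contains a completed set.\<close>
    have "\<exists>A\<in>sets_within H T. A \<subseteq> M" if T: "T \<in> act \<union> fresh" for T
    proof -
      have "maker_wins (sets_within H T) (M \<inter> T) M"
      proof (cases "T \<in> act")
        case False
        with T have "T \<in> fresh" by blast
        from fresh[OF this] True obtain x where "T \<subseteq> M" "x \<in> T" "maker_wins (sets_within H T) T {x}"
          by auto
        then show ?thesis by (auto elim!: maker_wins_mono)
      qed (use act True in auto)
      moreover have "M \<noteq> UNIV" using inf fin by auto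
      ultimately show ?thesis by (auto intro: maker_wins_final)
    qed
    then have "card (act \<union> fresh) \<le> score H s M"
      by (intro card_le_score H disj) auto
    then show ?thesis using True fin disj by (simp add: card_Un_disjoint)
  next
    case False
    have "card act + card fresh div 2 \<le> game_value H s Maker (U - {v}) M" if v: "v \<in> U" for v
    proof -
      \<comment> \<open>The points not claimed by Breaker once he has taken
        \<open>v\<close>.\<close>
      define C where "C = (U - {v}) \<union> M"
      have C: "C = (U \<union> M) - {v}" using v less.prems(3) by (auto simp: C_def)
      have away: "T \<subseteq> C" if "T \<in> fresh" "v \<notin> T" for T
        using fresh(1)[OF that(1)] that(2) C by blast
      have other: "maker_wins (sets_within H T) (C \<inter> T) M" if "T \<in> act" "v \<notin> T" for T
      proof -
        have "C \<inter> T = (U \<union> M) \<inter> T" using that C by blast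
        then show ?thesis using act[OF that(1)] by simp
      qed
      \<comment> \<open>It suffices to name Maker's target \<open>W\<close>, of at most one point,
        and new families with no smaller count whose fresh regions avoid \<open>v\<close>; the
        induction hypothesis does the rest.\<close>
      have reduce: "card act + card fresh div 2 \<le> game_value H s Maker (U - {v}) M"
        if W: "W \<subseteq> C" "W \<subseteq> {w}" and fin': "finite act'" "finite fresh'" "act' \<inter> fresh' = {}"
          and sub: "act' \<union> fresh' \<subseteq> act \<union> fresh" "fresh' \<subseteq> fresh"
          and le: "card act + card fresh div 2 \<le> card act' + card fresh' div 2"
          and act': "\<And>T. T \<in> act' \<Longrightarrow> maker_wins (sets_within H T) (C \<inter> T) (M \<union> W)"
          and fresh': "\<And>T. T \<in> fresh' \<Longrightarrow> v \<notin> T"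
        for W w act' fresh'
      proof (rule order_trans[OF le], rule game_value_Maker_ge)
        show "finite (U - {v})" "(U - {v}) \<inter> M = {}" "W \<subseteq> U - {v} \<union> M" "W \<subseteq> {w}"
          using fin less.prems(3) W by (auto simp: C_def)
        fix U' M'
        assume new: "U' \<subseteq> U - {v}" "U' \<union> M' = U - {v} \<union> M" "U' \<inter> M' = {}" "M \<union> W \<subseteq> M'"
        then have UM: "U' \<union> M' = C" by (simp add: C_def)
        show "card act' + card fresh' div 2 \<le> game_value H s Breaker U' M'"
        proof (rule less.hyps)
          show "card U' < card U" using new(1) v fin by (intro psubset_card_mono) auto
          have "finite (U' \<union> M')" using fin by (simp add: UM C_def)
          then show "finite U'" "finite M'" by auto
          show "pairwise disjnt (act' \<union> fresh')" using disj(2) sub(1) by (rule pairwise_subset)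
          show "maker_wins (sets_within H T) ((U' \<union> M') \<inter> T) M'" if "T \<in> act'" for T
            unfolding UM using act'[OF that] new(4) by (rule maker_wins_mono[OF _ order_refl])
          show "T \<subseteq> U' \<union> M'" if "T \<in> fresh'" for T
            unfolding UM using away fresh' sub(2) that by blast
          show "\<exists>x\<in>T. maker_wins (sets_within H T) T {x}" if "T \<in> fresh'" for T
            using fresh(2) sub(2) that by blast
        qed (use new fin' in auto)
      qed
      consider S where "S \<in> act" "v \<in> S" | S where "S \<in> fresh" "v \<in> S" | "v \<notin> \<Union>(act \<union> fresh)"
        by blast
      then show ?thesis
      proof cases
        case 1
        have uniq: "v \<notin> T" if "T \<in> act \<union> fresh" "T \<noteq> S" for T
          using disj(2) 1 that unfolding pairwise_def disjnt_def by blast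
        have "v \<notin> M" using v less.prems(3) by blast
        with act[OF 1(1)] obtain W w where W: "W \<subseteq> (U \<union> M) \<inter> S - {v}" "W \<subseteq> {w}"
          "maker_wins (sets_within H S) ((U \<union> M) \<inter> S - {v}) (M \<union> W)"
          by (rule maker_wins_reply)
        have CS: "(U \<union> M) \<inter> S - {v} = C \<inter> S" using C by blast
        show ?thesis
        proof (rule reduce[of W w act fresh])
          show "maker_wins (sets_within H T) (C \<inter> T) (M \<union> W)" if "T \<in> act" for T
          proof (cases "T = S")
            case False
            then have "maker_wins (sets_within H T) (C \<inter> T) M" using other uniq that by blast
            then show ?thesis by (rule maker_wins_mono) auto
          qed (use W(3) CS in simp)
          show "v \<notin> T" if "T \<in> fresh" for T
            using uniq[of T] that 1(1) disj(1) by blast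
        qed (use W C fin disj in auto)
      next
        case 2
        have uniq: "v \<notin> T" if "T \<in> act \<union> fresh" "T \<noteq> S" for T
          using disj(2) 2 that unfolding pairwise_def disjnt_def by blast
        have oth: "maker_wins (sets_within H T) (C \<inter> T) M" if "T \<in> act" for T
          using other[OF that] uniq[of T] that 2(1) disj(1) by blast
        show ?thesis
        \<comment> \<open>The region \<open>S\<close> entered by Breaker is given up. If it was the
          only fresh one, nothing is lost, as \<open>1 div 2 = 0\<close>; otherwise Maker opens
          another region \<open>T\<close>, trading two fresh regions for one active region.\<close>
        proof (cases "fresh = {S}")
          case True
          show ?thesis
            by (rule reduce[of "{}" v act "{}"]) (use True oth fin in auto)
        next
          case False
          then obtain T where T: "T \<in> fresh" "T \<noteq> S" using 2 by blast
          obtain x where x: "x \<in> T" "maker_wins (sets_within H T) T {x}"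
            using fresh(2)[OF T(1)] by blast
          have TC: "T \<subseteq> C" using away T uniq by blast
          then have CT: "C \<inter> T = T" by blast
          have "card {S, T} \<le> card fresh" using T 2(1) fin by (intro card_mono) auto
          then have "2 \<le> card fresh" using T(2) by simp
          moreover have "card (fresh - {S, T}) = card fresh - 2"
            using T 2(1) fin by (subst card_Diff_subset) auto
          moreover have "card (insert T act) = card act + 1"
            using T(1) fin disj(1) by (subst card_insert_disjoint) auto
          ultimately have le: "card act + card fresh div 2
              \<le> card (insert T act) + card (fresh - {S, T}) div 2"
            by linarith
          show ?thesis
          proof (rule reduce[of "{x}" x "insert T act" "fresh - {S, T}", OF _ _ _ _ _ _ _ le])
            show "maker_wins (sets_within H T') (C \<inter> T') (M \<union> {x})" if "T' \<in> insert T act" for T'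
            proof (cases "T' = T")
              case True
              then show ?thesis using x(2) CT by (auto elim!: maker_wins_mono)
            next
              case False
              with that have "maker_wins (sets_within H T') (C \<inter> T') M" by (intro oth) simp
              then show ?thesis by (rule maker_wins_mono) auto
            qed
          qed (use x TC T fin disj uniq in auto)
        qed
      next
        case 3
        show ?thesis
          by (rule reduce[of "{}" v act fresh]) (use 3 other fin disj in auto)
      qed
    qed
    then show ?thesis
      using False fin by (subst game_value.simps) auto
  qed
qed

text \<open>Maker's first move opens one of the \<open>r\<close> regions, and
  \<open>1 + (r - 1) div 2\<close> is at least \<open>r / 2\<close>.\<close>

lemma SC_ge_half_regions:
  fixes H :: "'a hypergraph"
  assumes inf: "infinite (UNIV :: 'a set)" and fin: "finite (fst H)"
    and H: "finite (snd H)" "\<And>A. A \<in> snd H \<Longrightarrow> A \<noteq> {} \<and> s \<le> card A"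
    and R: "finite R" "pairwise disjnt R" "\<And>T. T \<in> R \<Longrightarrow> T \<subseteq> fst H"
      "\<And>T. T \<in> R \<Longrightarrow> \<exists>x\<in>T. maker_wins (sets_within H T) T {x}"
  shows "card R \<le> 2 * SC H s"
proof (cases "R = {}")
  case False
  then obtain T where T: "T \<in> R" by blast
  obtain x where x: "x \<in> T" "maker_wins (sets_within H T) T {x}" using R(4)[OF T] by blast
  have "card {T} + card (R - {T}) div 2 \<le> game_value H s Maker (fst H) {}"
  proof (rule game_value_Maker_ge[of _ _ "{x}" x])
    fix U' M'
    assume new: "U' \<subseteq> fst H" "U' \<union> M' = fst H \<union> {}" "U' \<inter> M' = {}" "{} \<union> {x} \<subseteq> M'"
    have "finite (U' \<union> M')" using new fin by simp
    then have UM: "finite U'" "finite M'" by auto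
    show "card {T} + card (R - {T}) div 2 \<le> game_value H s Breaker U' M'"
    proof (rule game_value_Breaker_ge[OF inf H])
      have "(U' \<union> M') \<inter> T = T" using new R(3)[OF T] by blast
      then show "maker_wins (sets_within H T') ((U' \<union> M') \<inter> T') M'" if "T' \<in> {T}" for T'
        using that x(2) new(4) by (auto elim!: maker_wins_mono)
      show "pairwise disjnt ({T} \<union> (R - {T}))" using R(2) T by (simp add: insert_absorb)
    qed (use new R UM in auto)
  qed (use fin x R(3)[OF T] in auto)
  then show ?thesis using T R(1) by (simp add: SC_def card_Diff_singleton)
qed simp

section \<open>Stars\<close>

text \<open>The lattice points at distance 0, 1 and \<open>sqrt 3\<close> from the centre, each ring
  listed anticlockwise.\<close>

definition star :: "tri_vertex \<Rightarrow> tri_vertex set" where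
  "star = (\<lambda>(a, b). {(a, b),
     (a + 1, b), (a, b + 1), (a - 1, b + 1), (a - 1, b), (a, b - 1), (a + 1, b - 1),
     (a + 1, b + 1), (a - 1, b + 2), (a - 2, b + 1), (a - 1, b - 1), (a + 1, b - 2), (a + 2, b - 1)})"

text \<open>\<open>q r\<close> is the common edge; \<open>p \<noteq> s\<close> keeps the two
  triangles from coinciding.\<close>

lemma rhombusI:
  assumes "tri_dist p q = 1" "tri_dist p r = 1" "tri_dist q r = 1" "tri_dist s q = 1" "tri_dist s r = 1"
    and "p \<noteq> s"
  shows "rhombus {p, q, r, s}"
proof -
  have ne: "p \<noteq> q" "p \<noteq> r" "q \<noteq> r" "s \<noteq> q" "s \<noteq> r"
    using assms(1-5) by (auto simp: tri_dist_def)
  have "tri_dist q p = 1" "tri_dist r p = 1" "tri_dist r q = 1" "tri_dist q s = 1" "tri_dist r s = 1"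
    using assms(1-5) by (simp_all add: tri_dist_def dist_commute)
  with assms(1-5) ne have "unit_triangle {p, q, r}" "unit_triangle {q, r, s}"
    unfolding unit_triangle_def by simp_all
  moreover have "{p, q, r} \<inter> {q, r, s} = {q, r}" using ne assms(6) by auto
  then have "card ({p, q, r} \<inter> {q, r, s}) = 2" using ne by simp
  moreover have "{p, q, r, s} = {p, q, r} \<union> {q, r, s}" by auto
  ultimately show ?thesis unfolding rhombus_def by blast
qed

text \<open>Maker owns the centre; \<open>(x, y)\<close> is the direction opposite to the move of Breaker, and
  \<open>(- y, x + y)\<close> is \<open>(x, y)\<close> rotated by \<open>pi / 3\<close>.\<close>

lemma star_fan:
  assumes "(x, y) \<in> {(1, 0), (0, 1), (-1, 1), (-1, 0), (0, -1), (1, -1)}"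
    and "{(a + y, b - x - y), (a + x + y, b - x), (a + x, b + y), (a - y, b + x + y),
          (a - x - y, b + x), (a + 2 * x + y, b + y - x), (a + x - y, b + x + 2 * y)} \<subseteq> C"
  shows "\<exists>w\<in>C. maker_wins {R. rhombus R \<and> R \<subseteq> star (a, b)} C {w, (a, b)}"
\<comment> \<open>Here \<open>p2\<close> lies in direction \<open>(x, y)\<close>; \<open>p1\<close>,
  \<open>p0\<close> arise by clockwise and \<open>p3\<close>, \<open>p4\<close> by anticlockwise
  rotations through \<open>pi / 3\<close>. The offsets of \<open>t1\<close> and \<open>t2\<close>
  are the sums of those of \<open>p1\<close>, \<open>p2\<close> and of \<open>p2\<close>,
  \<open>p3\<close>.\<close>
proof (rule maker_wins_fan)
  have sub: "{(a, b), (a + y, b - x - y), (a + x + y, b - x), (a + x, b + y), (a - y, b + x + y),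
      (a - x - y, b + x), (a + 2 * x + y, b + y - x), (a + x - y, b + x + 2 * y)} \<subseteq> star (a, b)"
    using assms(1) unfolding star_def insert_iff prod.inject
    by (elim disjE conjE; simp)
  have "rhombus {(a + y, b - x - y), (a, b), (a + x + y, b - x), (a + x, b + y)}"
    "rhombus {(a, b), (a + x + y, b - x), (a + x, b + y), (a + 2 * x + y, b + y - x)}"
    "rhombus {(a + x + y, b - x), (a, b), (a + x, b + y), (a - y, b + x + y)}"
    "rhombus {(a, b), (a + x, b + y), (a - y, b + x + y), (a + x - y, b + x + 2 * y)}"
    "rhombus {(a + x, b + y), (a, b), (a - y, b + x + y), (a - x - y, b + x)}"
    using assms(1) by (auto simp: tri_dist_eq_1_iff intro!: rhombusI)
  with sub show "{(a + y, b - x - y), (a, b), (a + x + y, b - x), (a + x, b + y)} \<in> {R. rhombus R \<and> R \<subseteq> star (a, b)}"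
    "{(a, b), (a + x + y, b - x), (a + x, b + y), (a + 2 * x + y, b + y - x)} \<in> {R. rhombus R \<and> R \<subseteq> star (a, b)}"
    "{(a + x + y, b - x), (a, b), (a + x, b + y), (a - y, b + x + y)} \<in> {R. rhombus R \<and> R \<subseteq> star (a, b)}"
    "{(a, b), (a + x, b + y), (a - y, b + x + y), (a + x - y, b + x + 2 * y)} \<in> {R. rhombus R \<and> R \<subseteq> star (a, b)}"
    "{(a + x, b + y), (a, b), (a - y, b + x + y), (a - x - y, b + x)} \<in> {R. rhombus R \<and> R \<subseteq> star (a, b)}"
    by simp_all
  show "distinct [(a + y, b - x - y), (a + x + y, b - x), (a + x, b + y), (a - y, b + x + y), (a - x - y, b + x),
      (a + 2 * x + y, b + y - x), (a + x - y, b + x + 2 * y)]"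
    using assms(1) unfolding insert_iff prod.inject by (elim disjE conjE; simp)
qed (use assms(2) in auto)

text \<open>The fan in a given direction uses neither the opposite neighbour of the centre nor the
  four tips away from that direction, so some fan avoids Breaker's move.\<close>

lemma star_wins: "maker_wins {R. rhombus R \<and> R \<subseteq> star c} (star c) {c}"
proof (rule reply)
  fix v assume "v \<notin> {c}"
  obtain a b where c: "c = (a, b)" by force
  have "\<exists>x y. (x, y) \<in> {(1, 0), (0, 1), (-1, 1), (-1, 0), (0, -1), (1, -1)} \<and>
     {(a + y, b - x - y), (a + x + y, b - x), (a + x, b + y), (a - y, b + x + y),
      (a - x - y, b + x), (a + 2 * x + y, b + y - x), (a + x - y, b + x + 2 * y)} \<subseteq> star (a, b) - {v}"
  proof -
    \<comment> \<open>Each tip is paired with the adjacent neighbour clockwise of it; the fan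
      opposite to that neighbour avoids both.\<close>
    consider "v \<in> {(a + 1, b), (a + 1, b + 1)}"
    | "v \<in> {(a, b + 1), (a - 1, b + 2)}"
    | "v \<in> {(a - 1, b + 1), (a - 2, b + 1)}"
    | "v \<in> {(a - 1, b), (a - 1, b - 1)}"
    | "v \<in> {(a, b - 1), (a + 1, b - 2)}"
    | "v \<in> {(a + 1, b - 1), (a + 2, b - 1)}"
    | "v \<notin> star (a, b)"
      using \<open>v \<notin> {c}\<close> by (auto simp: star_def c)
    then show ?thesis
    proof cases
      case 1
      then show ?thesis
        by (intro exI[of _ "-1"] exI[of _ "0"]) (auto simp: star_def)
    next
      case 2
      then show ?thesis
        by (intro exI[of _ "0"] exI[of _ "-1"]) (auto simp: star_def)
    next
      case 3
      then show ?thesis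
        by (intro exI[of _ "1"] exI[of _ "-1"]) (auto simp: star_def)
    next
      case 4
      then show ?thesis
        by (intro exI[of _ "1"] exI[of _ "0"]) (auto simp: star_def)
    next
      case 5
      then show ?thesis
        by (intro exI[of _ "0"] exI[of _ "1"]) (auto simp: star_def)
    next
      case 6
      then show ?thesis
        by (intro exI[of _ "-1"] exI[of _ "1"]) (auto simp: star_def)
    next
      case 7
      then show ?thesis
        by (intro exI[of _ 1] exI[of _ 0]) (auto simp: star_def)
    qed
  qed
  then obtain x y where xy: "(x, y) \<in> {(1, 0), (0, 1), (-1, 1), (-1, 0), (0, -1), (1, -1)}"
     "{(a + y, b - x - y), (a + x + y, b - x), (a + x, b + y), (a - y, b + x + y),
      (a - x - y, b + x), (a + 2 * x + y, b + y - x), (a + x - y, b + x + 2 * y)} \<subseteq> star (a, b) - {v}"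
    by blast
  from star_fan[OF xy]
  show "\<exists>w\<in>star c - {v}. maker_wins {R. rhombus R \<and> R \<subseteq> star c} (star c - {v}) {w, c}"
    by (simp add: c)
qed

section \<open>Tiling of the lattice by stars\<close>

lemma card_star: "card (star c) = 13"
  by (cases c) (simp add: star_def)

lemma finite_star [simp]: "finite (star c)"
  by (cases c) (simp add: star_def)

text \<open>The sublattice of index 13 spanned by \<open>(3, 1)\<close> and its rotations: its minimal distance
  \<open>sqrt 13\<close> exceeds twice the radius \<open>sqrt 3\<close> of a star.\<close>

definition star_centres :: "tri_vertex set" where
  "star_centres = {(a, b). 13 dvd a - 3 * b}"

text \<open>The offsets of a star are closed under negation.\<close>

lemma star_commute: "p \<in> star c \<longleftrightarrow> c \<in> star p"
proof -
  have "c \<in> star p" if "p \<in> star c" for p c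
    using that by (cases p; cases c; simp add: star_def; elim disjE; simp)
  then show ?thesis by blast
qed

text \<open>The residue labels the cosets of the sublattice. Only surjectivity is checked on the
  offsets; injectivity follows because a star has 13 points.\<close>

lemma bij_betw_star_residues: "bij_betw (\<lambda>(a, b). (a - 3 * b) mod 13) (star p) {0..<13}"
proof -
  obtain a b where p: "p = (a, b)" by force
  have sub: "{0..<13} \<subseteq> (\<lambda>(a, b). (a - 3 * b) mod 13) ` star p"
  proof
    fix r :: int assume "r \<in> {0..<13}"
    then have r: "0 \<le> r" "r < 13" by auto
    define k0 where "k0 = (r - (a - 3 * b)) mod 13"
    \<comment> \<open>\<open>k\<close> is normalised to be a value of \<open>i - 3 * j\<close> at an offset \<open>(i, j)\<close> of the star.\<close>
    define k where "k = (if k0 \<le> 5 \<or> k0 = 7 then k0 else k0 - 13)"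
    have "k0 \<in> {0..12}" by (simp add: k0_def)
    also have "{0..12 :: int} = set [0..12]" by simp
    also have "\<dots> = {0, 1, 2, 3, 4, 5, 6, 7, 8, 9, 10, 11, 12}"
      by (simp add: upto_rec1 del: set_upto)
    finally have "k0 \<in> {0, 1, 2, 3, 4, 5, 6, 7, 8, 9, 10, 11, 12}" .
    then have k: "k = 0 \<or> k = 1 \<or> k = -3 \<or> k = -4 \<or> k = -1 \<or> k = 3 \<or> k = 4 \<or> k = -2
        \<or> k = -7 \<or> k = -5 \<or> k = 2 \<or> k = 7 \<or> k = 5"
      by (simp, elim disjE; simp add: k_def)
    have "(a - 3 * b + k0) mod 13 = r"
      using r unfolding k0_def by (simp add: mod_simps)
    moreover have "(a - 3 * b + (k0 - 13)) mod 13 = (a - 3 * b + k0) mod 13"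
      using minus_mod_self2[of "a - 3 * b + k0" 13] by (simp only: add_diff_eq)
    ultimately have r: "r = (a - 3 * b + k) mod 13" by (simp add: k_def)
    have "\<exists>c\<in>star p. fst c - 3 * snd c = a - 3 * b + k"
      using k unfolding p star_def by (elim disjE; simp)
    then show "r \<in> (\<lambda>(a, b). (a - 3 * b) mod 13) ` star p"
      unfolding r by (force simp: case_prod_unfold)
  qed
  have "card ((\<lambda>(a, b). (a - 3 * b) mod 13) ` star p) \<le> 13"
    using card_image_le[OF finite_star] by (simp add: card_star)
  with sub have eq: "(\<lambda>(a, b). (a - 3 * b) mod 13) ` star p = {0..<13}"
    by (intro card_seteq[symmetric]) auto
  then have "inj_on (\<lambda>(a, b). (a - 3 * b) mod 13) (star p)"
    by (intro eq_card_imp_inj_on) (simp_all add: card_star)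
  with eq show ?thesis by (simp add: bij_betw_def)
qed

text \<open>By symmetry, the centres whose stars cover \<open>p\<close> are the points of
  \<open>star p\<close> with residue 0, of which there is exactly one.\<close>

lemma ex1_star_centre: "\<exists>!c. c \<in> star_centres \<and> p \<in> star c"
proof -
  define f :: "tri_vertex \<Rightarrow> int" where "f = (\<lambda>(a, b). (a - 3 * b) mod 13)"
  have f: "inj_on f (star p)" "f ` star p = {0..<13}"
    using bij_betw_star_residues[of p] by (simp_all add: bij_betw_def f_def)
  have "0 \<in> f ` star p" unfolding f(2) by simp
  then obtain c where "c \<in> star p" "f c = 0" by (elim imageE) simp
  with f(1) have "\<exists>!c. c \<in> star p \<and> f c = 0"
    unfolding inj_on_def by metis
  moreover have "c \<in> star_centres \<longleftrightarrow> f c = 0" for c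
    by (cases c) (simp add: star_centres_def f_def dvd_eq_mod_eq_0)
  ultimately show ?thesis by (simp add: star_commute[of p] conj_commute)
qed

section \<open>Counting\<close>

text \<open>The walk, which may contain idle steps, has a first step leaving \<open>V\<close>; the
  point just before it lies on the boundary.\<close>

lemma grid_boundary_near:
  assumes "(p, q) \<in> {(p, q). p = q \<or> tri_dist p q = 1} ^^ k" "p \<in> V" "q \<notin> V"
  shows "\<exists>b\<in>grid_boundary V. tri_dist p b \<le> k"
  using assms
proof (induction k arbitrary: p)
  case (Suc k)
  from relpow_Suc_D2[OF Suc.prems(1)] obtain p' where
    p': "p = p' \<or> tri_dist p p' = 1" "(p', q) \<in> {(p, q). p = q \<or> tri_dist p q = 1} ^^ k" by auto
  show ?case
  proof (cases "p' \<in> V")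
    case True
    from Suc.IH[OF p'(2) True Suc.prems(3)] obtain b where
      b: "b \<in> grid_boundary V" "tri_dist p' b \<le> k" by blast
    have "tri_dist p p' \<le> 1" using p'(1) by (auto simp: tri_dist_def)
    moreover have "tri_dist p b \<le> tri_dist p p' + tri_dist p' b"
      by (simp add: tri_dist_def dist_triangle)
    ultimately show ?thesis using b by force
  next
    case False
    with p'(1) Suc.prems(2) have "p \<in> grid_boundary V"
      unfolding grid_boundary_def by blast
    then show ?thesis by (intro bexI[of _ p]) (auto simp: tri_dist_def)
  qed
qed auto

text \<open>A tip reaches the centre through an adjacent neighbour; idle steps cover the remaining
  points.\<close>

lemma star_path:
  assumes "p \<in> star c"
  shows "(p, c) \<in> {(p, q). p = q \<or> tri_dist p q = 1} ^^ 2"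
    and "(c, p) \<in> {(p, q). p = q \<or> tri_dist p q = 1} ^^ 2"
proof -
  obtain a b where c: "c = (a, b)" by force
  have "\<exists>m. (p = m \<or> tri_dist p m = 1) \<and> (m = c \<or> tri_dist m c = 1)"
  proof -
    consider "p \<in> {(a, b), (a + 1, b), (a, b + 1), (a - 1, b + 1), (a - 1, b), (a, b - 1), (a + 1, b - 1)}"
    | "p = (a + 1, b + 1)"
    | "p = (a - 1, b + 2)"
    | "p = (a - 2, b + 1)"
    | "p = (a - 1, b - 1)"
    | "p = (a + 1, b - 2)"
    | "p = (a + 2, b - 1)"
      using assms by (auto simp: star_def c)
    then show ?thesis
    proof cases
      case 1
      then show ?thesis by (intro exI[of _ p]) (auto simp: tri_dist_eq_1_iff c)
    next
      case 2
      then show ?thesis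
        by (intro exI[of _ "(a + 1, b)"]) (simp add: tri_dist_eq_1_iff c)
    next
      case 3
      then show ?thesis
        by (intro exI[of _ "(a, b + 1)"]) (simp add: tri_dist_eq_1_iff c)
    next
      case 4
      then show ?thesis
        by (intro exI[of _ "(a - 1, b + 1)"]) (simp add: tri_dist_eq_1_iff c)
    next
      case 5
      then show ?thesis
        by (intro exI[of _ "(a - 1, b)"]) (simp add: tri_dist_eq_1_iff c)
    next
      case 6
      then show ?thesis
        by (intro exI[of _ "(a, b - 1)"]) (simp add: tri_dist_eq_1_iff c)
    next
      case 7
      then show ?thesis
        by (intro exI[of _ "(a + 1, b - 1)"]) (simp add: tri_dist_eq_1_iff c)
    qed
  qed
  moreover have "tri_dist x y = tri_dist y x" for x y
    by (simp add: tri_dist_def dist_commute)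
  ultimately show "(p, c) \<in> {(p, q). p = q \<or> tri_dist p q = 1} ^^ 2"
    "(c, p) \<in> {(p, q). p = q \<or> tri_dist p q = 1} ^^ 2"
    by (auto simp: numeral_2_eq_2 relcomp_unfold)
qed

lemma star_subset_or_near_boundary:
  assumes "p \<in> star c" "p \<in> V" "\<not> star c \<subseteq> V"
  shows "\<exists>b\<in>grid_boundary V. tri_dist p b \<le> 4"
proof -
  obtain q where q: "q \<in> star c" "q \<notin> V" using assms by blast
  \<comment> \<open>Two steps from \<open>p\<close> to the centre \<open>c\<close>, and two more to
    the missing point \<open>q\<close>.\<close>
  have "(p, q) \<in> {(p, q). p = q \<or> tri_dist p q = 1} ^^ (2 + 2)"
    unfolding relpow_add using star_path assms q by blast
  from grid_boundary_near[OF this assms(2) q(2)] show ?thesis by simp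
qed

text \<open>A rhombus is determined by its short diagonal.\<close>

definition rhombus_at :: "tri_vertex \<times> tri_vertex \<Rightarrow> tri_vertex set" where
  "rhombus_at = (\<lambda>((a, b), (x, y)).
     {(a, b), (a + x, b + y), (a - y, b + x + y), (a + x + y, b - x)})"

text \<open>The candidates are the apexes of the two unit triangles on the edge, obtained by
  rotating \<open>(x, y)\<close> by \<open>pi / 3\<close> either way about
  \<open>(a, b)\<close>.\<close>

lemma common_neighbour:
  assumes "(x, y) \<in> {(1, 0), (0, 1), (-1, 1)}"
    and "tri_dist p (a, b) = 1" "tri_dist p (a + x, b + y) = 1"
  shows "p \<in> {(a - y, b + x + y), (a + x + y, b - x)}"
proof -
  obtain i j where p: "p = (a + i, b + j)"
    by (metis add.commute diff_add_cancel prod.collapse)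
  have "(i, j) \<in> {(1, 0), (0, 1), (-1, 1), (-1, 0), (0, -1), (1, -1)}"
    using assms(2) unfolding p tri_dist_eq_1_iff by auto
  then show ?thesis
    using assms(1,3) unfolding p tri_dist_eq_1_iff by (simp, elim disjE; simp)
qed

text \<open>The two shared vertices form the short diagonal. The other two vertices are distinct
  common neighbours of its ends, hence are exactly the two apexes.\<close>

lemma rhombus_imp_rhombus_at:
  assumes "rhombus R"
  obtains q d where "d \<in> {(1, 0), (0, 1), (-1, 1)}" "R = rhombus_at (q, d)"
proof -
  note result = that
  obtain S T where ST: "unit_triangle S" "unit_triangle T" "card (S \<inter> T) = 2" "R = S \<union> T"
    using assms by (auto simp: rhombus_def)
  have third: "\<exists>p. X = insert p E \<and> p \<notin> E" if "unit_triangle X" "E \<subseteq> X" "card E = 2" for X E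
  proof -
    have "card X = 3" "finite E" using that by (auto simp: unit_triangle_def intro: card_ge_0_finite)
    then have "card (X - E) = 1" using that by (simp add: card_Diff_subset)
    then obtain p where "X - E = {p}" by (auto simp: card_1_singleton_iff)
    then show ?thesis using that(2) by blast
  qed
  obtain p where p: "S = insert p (S \<inter> T)" "p \<notin> S \<inter> T" using third[OF ST(1) _ ST(3)] by blast
  obtain s where s: "T = insert s (S \<inter> T)" "s \<notin> S \<inter> T" using third[OF ST(2) _ ST(3)] by blast
  have "p \<noteq> s" using p s by blast
  obtain q r where qr: "S \<inter> T = {q, r}" "q \<noteq> r" using ST(3) by (auto simp: card_2_iff)
  have dist: "tri_dist u v = 1" if "u \<in> S \<and> v \<in> S \<or> u \<in> T \<and> v \<in> T" "u \<noteq> v" for u v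
    using ST that by (auto simp: unit_triangle_def)
  have in_ST: "q \<in> S" "r \<in> S" "p \<in> S" "q \<in> T" "r \<in> T" "s \<in> T" using p s qr by blast+
  have R: "R = {p, s, q, r}" using ST(4) p s qr by blast
  have main: thesis if d: "(x, y) \<in> {(1, 0), (0, 1), (-1, 1)}"
    and E: "{q, r} = {(a, b), (a + x, b + y)}" for a b x y
  proof -
    have "{(a, b), (a + x, b + y)} \<subseteq> S \<inter> T" using qr(1) E by simp
    then have "t \<in> {(a - y, b + x + y), (a + x + y, b - x)}" if "t \<in> {p, s}" for t
      by (intro common_neighbour[OF d] dist) (use that p s in blast)+
    then have "{p, s} = {(a - y, b + x + y), (a + x + y, b - x)}" using \<open>p \<noteq> s\<close> by blast
    then have "R = {(a, b), (a + x, b + y)} \<union> {(a - y, b + x + y), (a + x + y, b - x)}"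
      using R E by blast
    then have "R = rhombus_at ((a, b), (x, y))" by (auto simp: rhombus_at_def)
    with d show thesis by (rule result)
  qed
  obtain a b a' b' where ab: "q = (a, b)" "r = (a', b')" by force
  have "tri_dist q r = 1" using dist in_ST qr(2) by blast
  \<comment> \<open>Swapping the ends of the diagonal reduces six oriented directions to
    three.\<close>
  then have "(a' - a, b' - b) \<in> {(1, 0), (0, 1), (-1, 1)}
      \<or> (a - a', b - b') \<in> {(1, 0), (0, 1), (-1, 1)}"
    unfolding ab tri_dist_eq_1_iff by auto
  then show thesis
  proof
    assume "(a' - a, b' - b) \<in> {(1, 0), (0, 1), (-1, 1)}"
    then show thesis by (rule main[of _ _ a b]) (simp add: ab)
  next
    assume "(a - a', b - b') \<in> {(1, 0), (0, 1), (-1, 1)}"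
    then show thesis by (rule main[of _ _ a' b']) (simp add: ab insert_commute)
  qed
qed

text \<open>A rhombus is charged to the star containing the base point \<open>q\<close> of its short
  diagonal: 13 points with 3 directions give 39 per star. If that star is not inside
  \<open>V\<close>, the rhombus is near the boundary.\<close>

lemma card_rhombi_le:
  assumes "finite V"
  shows "card (snd (rhombus_grid V))
    \<le> 39 * card (star ` {c \<in> star_centres. star c \<subseteq> V}) + card (sets_near_boundary 4 V)"
proof -
  define S where "S = star ` {c \<in> star_centres. star c \<subseteq> V}"
  define D :: "tri_vertex set" where "D = {(1, 0), (0, 1), (-1, 1)}"
  have "finite S" using assms by (auto simp: S_def intro: finite_subset[of _ "Pow V"])
  moreover have "finite T" if "T \<in> S" for T using that by (auto simp: S_def)
  ultimately have fin: "finite (\<Union>S \<times> D)" by (simp add: D_def)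
  have "snd (rhombus_grid V) \<subseteq> rhombus_at ` (\<Union>S \<times> D) \<union> sets_near_boundary 4 V"
  proof
    fix R assume R: "R \<in> snd (rhombus_grid V)"
    then have "rhombus R" "R \<subseteq> V" by (auto simp: rhombus_grid_def)
    then obtain q d where qd: "d \<in> D" "R = rhombus_at (q, d)"
      unfolding D_def by (elim rhombus_imp_rhombus_at)
    have "q \<in> R" unfolding qd by (auto simp: rhombus_at_def split: prod.splits)
    then have "q \<in> V" using \<open>R \<subseteq> V\<close> by blast
    obtain c where c: "c \<in> star_centres" "q \<in> star c" using ex1_star_centre by blast
    show "R \<in> rhombus_at ` (\<Union>S \<times> D) \<union> sets_near_boundary 4 V"
    proof (cases "star c \<subseteq> V")
      case True
      then show ?thesis using c qd by (auto simp: S_def)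
    next
      case False
      then show ?thesis
        using star_subset_or_near_boundary[OF c(2) \<open>q \<in> V\<close>] \<open>q \<in> R\<close> R
        by (auto simp: sets_near_boundary_def)
    qed
  qed
  moreover have "finite (sets_near_boundary 4 V)"
    using assms by (auto simp: sets_near_boundary_def rhombus_grid_def intro: finite_subset[of _ "Pow V"])
  ultimately have "card (snd (rhombus_grid V))
      \<le> card (rhombus_at ` (\<Union>S \<times> D) \<union> sets_near_boundary 4 V)"
    using fin by (intro card_mono) auto
  also have "\<dots> \<le> card (rhombus_at ` (\<Union>S \<times> D)) + card (sets_near_boundary 4 V)"
    by (rule card_Un_le)
  also have "card (rhombus_at ` (\<Union>S \<times> D)) \<le> card (\<Union>S \<times> D)"
    using fin by (rule card_image_le)
  also have "card (\<Union>S \<times> D) = card (\<Union>S) * 3"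
    by (simp add: card_cartesian_product D_def)
  also have "card (\<Union>S) \<le> (\<Sum>T\<in>S. card T)"
    by (rule card_Union_le_sum_card)
  also have "(\<Sum>T\<in>S. card T) = card S * 13"
    by (subst sum.cong[OF refl, of _ _ "\<lambda>_. 13"]) (auto simp: S_def card_star)
  finally show ?thesis by (simp add: S_def)
qed

text \<open>Maker wins at least half of the stars inside \<open>V\<close>, and each star accounts
  for at most 39 rhombi, whence the factor 78.\<close>

lemma SC_rhombus_grid_ge:
  assumes "finite V"
  shows "card (snd (rhombus_grid V)) \<le> 78 * SC (rhombus_grid V) 4 + card (sets_near_boundary 4 V)"
proof -
  define S where "S = star ` {c \<in> star_centres. star c \<subseteq> V}"
  have "card S \<le> 2 * SC (rhombus_grid V) 4"
  proof (rule SC_ge_half_regions)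
    show "infinite (UNIV :: tri_vertex set)" by (simp add: finite_prod)
    show "finite (fst (rhombus_grid V))" using assms by (simp add: rhombus_grid_def)
    show "finite (snd (rhombus_grid V))"
      using assms by (auto simp: rhombus_grid_def intro: finite_subset[of _ "Pow V"])
    show "A \<noteq> {} \<and> 4 \<le> card A" if "A \<in> snd (rhombus_grid V)" for A
      using rhombus_grid_uniform[OF assms] that by (auto simp: uniform_hypergraph_def)
    show "finite S" using assms by (auto simp: S_def intro: finite_subset[of _ "Pow V"])
    show "pairwise disjnt S"
      unfolding S_def pairwise_def disjnt_def using ex1_star_centre by blast
    show "T \<subseteq> fst (rhombus_grid V)" if "T \<in> S" for T
      using that by (auto simp: S_def rhombus_grid_def)
    show "\<exists>x\<in>T. maker_wins (sets_within (rhombus_grid V) T) T {x}" if "T \<in> S" for T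
    proof -
      from that obtain c where c: "T = star c" "star c \<subseteq> V" unfolding S_def by blast
      have "sets_within (rhombus_grid V) T = {R. rhombus R \<and> R \<subseteq> star c}"
        using c by (auto simp: sets_within_def rhombus_grid_def)
      moreover have "c \<in> T" by (cases c) (simp add: c(1) star_def)
      ultimately show ?thesis using star_wins[of c] c(1) by auto
    qed
  qed
  with card_rhombi_le[OF assms] show ?thesis by (simp add: S_def)
qed

theorem theorem17:
  fixes V :: "nat \<Rightarrow> tri_vertex set" and n :: "nat \<Rightarrow> nat"
  assumes "\<And>i. finite (V i)"
    and "\<And>i. n i = card (snd (rhombus_grid (V i)))"
    and "filterlim n at_top sequentially"
    and "\<And>d. (\<lambda>i. real (card (sets_near_boundary d (V i)))) \<in> o(\<lambda>i. real (n i))"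
  shows "\<exists>e \<in> o(\<lambda>i. real (n i)).
           \<forall>i. real (SC (rhombus_grid (V i)) 4) \<ge> real (n i) / 78 - e i"
proof
  \<comment> \<open>The error term comes from the rhombi within distance 4 of the boundary, where a
    star may leave \<open>V\<close>.\<close>
  show "(\<lambda>i. real (card (sets_near_boundary 4 (V i))) / 78) \<in> o(\<lambda>i. real (n i))"
    using assms(4)[of 4] by simp
  show "\<forall>i. real (SC (rhombus_grid (V i)) 4)
      \<ge> real (n i) / 78 - real (card (sets_near_boundary 4 (V i))) / 78"
  proof
    fix i
    have "real (n i) \<le> 78 * real (SC (rhombus_grid (V i)) 4) + real (card (sets_near_boundary 4 (V i)))"
      using SC_rhombus_grid_ge[OF assms(1)] assms(2)[of i]
      by (metis (mono_tags) of_nat_add of_nat_le_iff of_nat_mult of_nat_numeral)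
    then show "real (SC (rhombus_grid (V i)) 4)
        \<ge> real (n i) / 78 - real (card (sets_near_boundary 4 (V i))) / 78" by simp
  qed
qed

end
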